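(* Let $G$ be a finite simple graph, let $\Gamma\subseteq\Omega(G)$ and $\emptyset\neq\Gamma'\subseteq\mathrm{MaxCritIndep}(G)$ be such that for every $A\in\Gamma'$ there exists $S\in\Gamma$ with $A\subseteq S$. If $\bigcap\Gamma$ is a critical set, then: (i) $\bigcap\Gamma\subseteq\bigcap\Gamma'$; (ii) $\Gamma'\vartriangleleft\Gamma$; (iii) $\left|\bigcap\Gamma'\right|+\left|\bigcup\Gamma'\right|\leq\left|\bigcap\Gamma\right|+\left|\bigcup\Gamma\right|$; (iv) if, in addition, $\bigcup\Gamma'=\bigcup\Gamma$, then $\bigcap\Gamma'=\bigcap\Gamma$.
   Context: For a graph $G$ and $A\subseteq V(G)$: $N(A)=\{v\in V(G): v \text{ has a neighbor in } A\}$. A set is independent if no two of its vertices are adjacent; $\mathrm{Ind}(G)$ is the family of independent sets and $\Omega(G)$ the family of all maximum independent sets. The difference of $X\subseteq V(G)$ is $d(X)=|X|-|N(X)|$. An independent set $A$ is critical if $d(A)=\max\{d(I):I\in\mathrm{Ind}(G)\}$. A maximum critical independent set is a critical independent set of maximum cardinality among all critical independent sets; $\mathrm{MaxCritIndep}(G)$ denotes the family of all of them. For collections of sets $\Gamma,\Gamma'$, write $\Gamma'\vartriangleleft\Gamma$ if $\bigcup\Gamma'\subseteq\bigcup\Gamma$ and $\bigcap\Gamma\subseteq\bigcap\Gamma'$. *)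

theory Defs
  imports "Graph_Theory.Digraph"
begin

text \<open>
  A finite simple graph is a value \<open>G\<close> satisfying the locale predicate \<open>graph G\<close>: a finite
  digraph without loops and without parallel arcs whose adjacency relation
  \<open>u \<rightarrow>\<^bsub>G\<^esub> v\<close> is symmetric, an edge \<open>uv\<close> being represented by its two orientations.
  The null graph is allowed.
\<close>

definition nbhd :: "('a, 'b) pre_digraph \<Rightarrow> 'a set \<Rightarrow> 'a set" where
  "nbhd G A = {v \<in> verts G. \<exists>u \<in> A. v \<rightarrow>\<^bsub>G\<^esub> u}"

definition Ind :: "('a, 'b) pre_digraph \<Rightarrow> 'a set set" where
  "Ind G = {A. A \<subseteq> verts G \<and> (\<forall>u \<in> A. \<forall>v \<in> A. \<not> u \<rightarrow>\<^bsub>G\<^esub> v)}"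

definition max_Ind :: "('a, 'b) pre_digraph \<Rightarrow> 'a set set" where
  "max_Ind G = {S \<in> Ind G. \<forall>T \<in> Ind G. card T \<le> card S}"

text \<open>The difference may be negative, hence the integers.\<close>

definition set_diff_val :: "('a, 'b) pre_digraph \<Rightarrow> 'a set \<Rightarrow> int" where
  "set_diff_val G X = int (card X) - int (card (nbhd G X))"

definition critical :: "('a, 'b) pre_digraph \<Rightarrow> 'a set \<Rightarrow> bool" where
  "critical G A \<longleftrightarrow> A \<in> Ind G \<and> set_diff_val G A = Max (set_diff_val G ` Ind G)"

definition MaxCritIndep :: "('a, 'b) pre_digraph \<Rightarrow> 'a set set" where
  "MaxCritIndep G = {A. critical G A \<and> (\<forall>B. critical G B \<longrightarrow> card B \<le> card A)}"

text \<open>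
  For an empty family the library has \<open>\<Inter>{} = UNIV\<close>, which is not the vertex set; the relation
  below is meant for nonempty families.
\<close>

definition family_le :: "'a set set \<Rightarrow> 'a set set \<Rightarrow> bool" (infix \<open>\<lhd>\<close> 50) where
  "\<Gamma>' \<lhd> \<Gamma> \<longleftrightarrow> \<Union>\<Gamma>' \<subseteq> \<Union>\<Gamma> \<and> \<Inter>\<Gamma> \<subseteq> \<Inter>\<Gamma>'"

end

theory Submission
  imports Defs
begin

text \<open>
  The difference \<open>d\<close> is supermodular, so an independent union of critical sets is critical. Hence
  \<open>A \<union> \<Inter>\<Gamma>\<close> (inside some \<open>S \<in> \<Gamma>\<close>) is critical for every \<open>A \<in> \<Gamma>'\<close>, and \<open>\<Inter>\<Gamma> \<subseteq> A\<close> by maximality of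
  \<open>A\<close>. For the inequality, let \<open>C' = \<Inter>\<Gamma>'\<close>: enumerating \<open>\<Gamma>\<close> as \<open>S\<^sub>1, S\<^sub>2, \<dots>\<close>, the sets
  \<open>E\<^sub>i = (C' \<inter> S\<^sub>1 \<inter> \<dots> \<inter> S\<^sub>i\<^sub>-\<^sub>1) - S\<^sub>i\<close> partition \<open>C' - \<Inter>\<Gamma>\<close>. Exchanging \<open>N(E\<^sub>i) \<inter> S\<^sub>i\<close> for \<open>E\<^sub>i\<close> in \<open>S\<^sub>i\<close>
  gives \<open>|E\<^sub>i| \<le> |N(E\<^sub>i) \<inter> S\<^sub>i|\<close>, and these neighbourhoods are disjoint from the earlier \<open>S\<^sub>j\<close>, so
  \<open>|C' - \<Inter>\<Gamma>| \<le> |N(C') \<inter> \<Union>\<Gamma>|\<close>. Finally \<open>N(C')\<close> avoids \<open>\<Union>\<Gamma>'\<close>.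
\<close>

lemma Ind_subset: "A \<in> Ind G \<Longrightarrow> B \<subseteq> A \<Longrightarrow> B \<in> Ind G"
  by (auto simp: Ind_def)

lemma Ind_nbhd_disjoint: "A \<in> Ind G \<Longrightarrow> B \<subseteq> A \<Longrightarrow> nbhd G B \<inter> A = {}"
  by (auto simp: Ind_def nbhd_def)

lemma nbhd_mono: "A \<subseteq> B \<Longrightarrow> nbhd G A \<subseteq> nbhd G B"
  by (auto simp: nbhd_def)

lemma nbhd_Un: "nbhd G (A \<union> B) = nbhd G A \<union> nbhd G B"
  by (auto simp: nbhd_def)

context graph
begin

lemma finite_Ind_mem: "A \<in> Ind G \<Longrightarrow> finite A"
  using finite_subset[OF _ finite_verts] by (auto simp: Ind_def)

lemma finite_Ind: "finite (Ind G)"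
  by (rule finite_subset[of _ "Pow (verts G)"]) (auto simp: Ind_def)

lemma finite_nbhd: "finite (nbhd G A)"
  by (simp add: nbhd_def)

text \<open>Cardinality is modular and \<open>nbhd\<close> commutes with unions, but a common
  neighbour of \<open>A\<close> and \<open>B\<close> need not have a neighbour in
  \<open>A \<inter> B\<close>; hence only an inequality.\<close>

lemma set_diff_val_supermodular:
  assumes "finite A" "finite B"
  shows "set_diff_val G A + set_diff_val G B
    \<le> set_diff_val G (A \<union> B) + set_diff_val G (A \<inter> B)"
proof -
  have "card (nbhd G (A \<inter> B)) \<le> card (nbhd G A \<inter> nbhd G B)"
    by (intro card_mono) (auto simp: finite_nbhd nbhd_def)
  then show ?thesis
    using card_Un_Int[OF assms] card_Un_Int[OF finite_nbhd[of A] finite_nbhd[of B]]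
    by (simp add: set_diff_val_def nbhd_Un)
qed

text \<open>\<open>A \<inter> B\<close> is independent, so its difference is at most the maximum;
  supermodularity leaves the union no less than the maximum.\<close>

lemma critical_Un:
  assumes "critical G A" "critical G B" "A \<union> B \<in> Ind G"
  shows "critical G (A \<union> B)"
proof -
  let ?M = "Max (set_diff_val G ` Ind G)"
  have le: "set_diff_val G X \<le> ?M" if "X \<in> Ind G" for X
    using that finite_Ind by simp
  have "A \<in> Ind G" "B \<in> Ind G" "set_diff_val G A = ?M" "set_diff_val G B = ?M"
    using assms by (auto simp: critical_def)
  moreover have "set_diff_val G (A \<inter> B) \<le> ?M"
    using \<open>A \<in> Ind G\<close> by (intro le) (auto intro: Ind_subset)
  ultimately have "set_diff_val G (A \<union> B) = ?M"
    using set_diff_val_supermodular[OF finite_Ind_mem finite_Ind_mem, of A B] le[OF assms(3)]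
    by simp
  then show ?thesis
    using assms(3) by (simp add: critical_def)
qed

lemma sym_adj: "u \<rightarrow> v \<Longrightarrow> v \<rightarrow> u"
  using sym_arcs by (auto simp: symmetric_def elim: symE)

lemma Ind_exchange:
  assumes "S \<in> Ind G" "E \<in> Ind G"
  shows "(S - nbhd G E) \<union> E \<in> Ind G"
  using assms unfolding Ind_def nbhd_def by (blast dest: sym_adj)

lemma card_le_nbhd_max_Ind:
  assumes "S \<in> max_Ind G" "E \<in> Ind G" "E \<inter> S = {}"
  shows "card E \<le> card (nbhd G E \<inter> S)"
proof -
  have S: "S \<in> Ind G" "finite S" "finite E"
    using assms finite_Ind_mem by (auto simp: max_Ind_def)
  have "card (S - nbhd G E) + card E = card ((S - nbhd G E) \<union> E)"
    using S assms(3) by (subst card_Un_disjoint) auto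
  also have "\<dots> \<le> card S"
    using assms Ind_exchange[OF S(1) assms(2)] by (auto simp: max_Ind_def)
  also have "card S = card (S - nbhd G E) + card (nbhd G E \<inter> S)"
    using card_Diff_subset_Int[of S "nbhd G E"] card_mono[of S "S \<inter> nbhd G E"] S
    by (simp add: Int_commute)
  finally show ?thesis by simp
qed

lemma card_Diff_Inter_le:
  assumes "finite F" "F \<subseteq> max_Ind G" "D \<in> Ind G"
  shows "card (D - \<Inter>F) \<le> card (nbhd G D \<inter> \<Union>F)"
  using assms
proof (induction F)
  case empty
  then show ?case by simp
next
  case (insert S F)
  \<comment> \<open>The elements of \<open>D\<close> that leave the intersection exactly when
    \<open>S\<close> joins \<open>F\<close>. If \<open>F\<close> is empty, \<open>\<Inter>F\<close>
    is \<open>UNIV\<close> and \<open>E\<close> is \<open>D - S\<close>.\<close>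
  define E where "E = D \<inter> \<Inter>F - S"
  have fin: "finite D" and E: "E \<in> Ind G"
    using insert.prems finite_Ind_mem by (auto simp: E_def intro: Ind_subset)
  \<comment> \<open>\<open>E\<close> lies inside every independent set \<open>T\<close> of
    \<open>F\<close>, so the neighbours of \<open>E\<close> in \<open>S\<close> were not counted
    before.\<close>
  have "nbhd G E \<inter> T = {}" if "T \<in> F" for T
    using that insert.prems by (intro Ind_nbhd_disjoint) (auto simp: E_def max_Ind_def)
  then have disj: "(nbhd G D \<inter> \<Union>F) \<inter> (nbhd G E \<inter> S) = {}"
    by auto
  have "D - \<Inter>(insert S F) = (D - \<Inter>F) \<union> E"
    by (auto simp: E_def)
  then have "card (D - \<Inter>(insert S F)) \<le> card (D - \<Inter>F) + card E"
    by (simp add: card_Un_le)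
  also have "\<dots> \<le> card (nbhd G D \<inter> \<Union>F) + card (nbhd G E \<inter> S)"
    using insert card_le_nbhd_max_Ind[of S E] E by (intro add_mono) (auto simp: E_def)
  also have "\<dots> = card ((nbhd G D \<inter> \<Union>F) \<union> (nbhd G E \<inter> S))"
    using disj by (simp add: card_Un_disjoint finite_nbhd)
  also have "\<dots> \<le> card (nbhd G D \<inter> \<Union>(insert S F))"
    using nbhd_mono[of E D G] by (intro card_mono) (auto simp: finite_nbhd E_def)
  finally show ?case .
qed

end

theorem theorem2p7:
  fixes G :: "('a, 'b) pre_digraph" and \<Gamma> \<Gamma>' :: "'a set set"
  assumes "graph G"
    and "\<Gamma> \<subseteq> max_Ind G"
    and "\<Gamma>' \<noteq> {}" and "\<Gamma>' \<subseteq> MaxCritIndep G"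
    and "\<forall>A \<in> \<Gamma>'. \<exists>S \<in> \<Gamma>. A \<subseteq> S"
    and "critical G (\<Inter>\<Gamma>)"
  shows "\<Inter>\<Gamma> \<subseteq> \<Inter>\<Gamma>'
    \<and> \<Gamma>' \<lhd> \<Gamma>
    \<and> card (\<Inter>\<Gamma>') + card (\<Union>\<Gamma>') \<le> card (\<Inter>\<Gamma>) + card (\<Union>\<Gamma>)
    \<and> (\<Union>\<Gamma>' = \<Union>\<Gamma> \<longrightarrow> \<Inter>\<Gamma>' = \<Inter>\<Gamma>)"
proof -
  interpret graph G by fact
  have \<Gamma>_Ind: "\<Gamma> \<subseteq> Ind G" and \<Gamma>'_Ind: "\<Gamma>' \<subseteq> Ind G"
    using assms(2,4) by (auto simp: max_Ind_def MaxCritIndep_def critical_def)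
  have sub: "\<Inter>\<Gamma> \<subseteq> A" if A\<Gamma>': "A \<in> \<Gamma>'" for A
  proof -
    obtain S where S: "S \<in> \<Gamma>" "A \<subseteq> S"
      using assms(5) A\<Gamma>' by blast
    have A: "critical G A" "\<And>B. critical G B \<Longrightarrow> card B \<le> card A"
      using assms(4) A\<Gamma>' by (auto simp: MaxCritIndep_def)
    have un: "A \<union> \<Inter>\<Gamma> \<in> Ind G"
      by (rule Ind_subset[of S]) (use S \<Gamma>_Ind in auto)
    have "card (A \<union> \<Inter>\<Gamma>) \<le> card A"
      using A critical_Un[OF A(1) assms(6) un] by blast
    then have "A = A \<union> \<Inter>\<Gamma>"
      using finite_Ind_mem[OF un] by (intro card_seteq) auto
    then show ?thesis by blast
  qed
  have Inter: "\<Inter>\<Gamma> \<subseteq> \<Inter>\<Gamma>'"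
    using sub by blast
  have Union: "\<Union>\<Gamma>' \<subseteq> \<Union>\<Gamma>"
    using assms(5) by blast
  \<comment> \<open>A member is needed to bound \<open>\<Inter>\<Gamma>'\<close>, which would be
    \<open>UNIV\<close> for an empty family.\<close>
  obtain A where "A \<in> \<Gamma>'"
    using assms(3) by blast
  then have C': "\<Inter>\<Gamma>' \<in> Ind G"
    using \<Gamma>'_Ind Ind_subset[of A G "\<Inter>\<Gamma>'"] by blast
  have fin\<Gamma>: "finite \<Gamma>"
    using \<Gamma>_Ind finite_Ind by (rule finite_subset)
  then have fin: "finite (\<Inter>\<Gamma>')" "finite (\<Union>\<Gamma>)"
    using finite_Ind_mem[OF C'] \<Gamma>_Ind finite_Ind_mem by blast+
  have "nbhd G (\<Inter>\<Gamma>') \<inter> A = {}" if "A \<in> \<Gamma>'" for A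
    using that \<Gamma>'_Ind by (intro Ind_nbhd_disjoint) auto
  then have "nbhd G (\<Inter>\<Gamma>') \<inter> \<Union>\<Gamma> \<subseteq> \<Union>\<Gamma> - \<Union>\<Gamma>'"
    by blast
  then have "card (\<Inter>\<Gamma>' - \<Inter>\<Gamma>) \<le> card (\<Union>\<Gamma> - \<Union>\<Gamma>')"
    using card_Diff_Inter_le[OF fin\<Gamma> assms(2) C'] card_mono[OF finite_Diff[OF fin(2)]]
    by (meson order_trans)
  then have card: "card (\<Inter>\<Gamma>') + card (\<Union>\<Gamma>') \<le> card (\<Inter>\<Gamma>) + card (\<Union>\<Gamma>)"
    using card_Diff_subset[OF finite_subset[OF Inter fin(1)] Inter]
      card_Diff_subset[OF finite_subset[OF Union fin(2)] Union]
      card_mono[OF fin(1) Inter] card_mono[OF fin(2) Union] by linarith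
  \<comment> \<open>With equal unions, the inequality bounds the larger intersection by the size of
    the smaller one.\<close>
  moreover have "\<Inter>\<Gamma>' = \<Inter>\<Gamma>" if "\<Union>\<Gamma>' = \<Union>\<Gamma>"
    using card that card_seteq[OF fin(1) Inter] by simp
  ultimately show ?thesis
    using Inter Union by (simp add: family_le_def)
qed

end
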